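(* Let $\langle \mathcal{P}, \sigma, \mathcal{Q} \rangle$ be an X-DCOP, where $\mathcal{P} = \langle \mathbf{A}, \mathbf{X}, \mathbf{D}, \mathbf{F}, \alpha \rangle$ is a DCOP, $\sigma$ is a complete solution of $\mathcal{P}$, and $\mathcal{Q} = \langle a_Q, \sigma_Q, \hat{\sigma}_Q \rangle$ is a query. Let $k$ be a positive integer. If $\sigma$ is a $k$-optimal solution and the number of variables in the query is not greater than $k$, i.e. $|\mathrm{var}(\sigma_Q)| = |\mathrm{var}(\hat{\sigma}_Q)| \leq k$, then a valid (contrastive) explanation for $\langle \mathcal{P}, \sigma, \mathcal{Q} \rangle$ exists.
   Context: A DCOP (Distributed Constraint Optimization Problem) is a tuple $\langle \mathbf{A}, \mathbf{X}, \mathbf{D}, \mathbf{F}, \alpha \rangle$ where $\mathbf{A}$ is a finite set of agents; $\mathbf{X}$ is a finite set of variables; $\mathbf{D} = \{D_x\}_{x\in\mathbf{X}}$ is a family of finite domains; $\mathbf{F}$ is a finite set of constraints, each constraint $f$ having a scope $\mathbf{x}^f \subseteq \mathbf{X}$ and being a function $f : \prod_{x \in \mathbf{x}^f} D_x \to \mathbb{R} \cup \{\infty\}$ (infeasible configurations have cost $\infty$); and $\alpha : \mathbf{X} \to \mathbf{A}$ maps each variable to an agent. A solution $\sigma$ is an assignment of values $\sigma(x) \in D_x$ to the variables $x$ in some set $\mathrm{var}(\sigma) \subseteq \mathbf{X}$; it is complete if $\mathrm{var}(\sigma) = \mathbf{X}$. For a complete solution $\tau$, $f(\tau)$ denotes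 the value of $f$ at the restriction of $\tau$ to $\mathbf{x}^f$ (the constraint $f$ "grounded by" $\tau$), and the total cost is $\mathbf{F}(\tau) = \sum_{f\in\mathbf{F}} f(\tau)$. Costs are minimized. A complete solution is $k$-optimal if no change in the value assignments of $k$ or fewer variables improves it, i.e. yields a complete solution of strictly smaller total cost. An X-DCOP is a tuple $\langle \mathcal{P}, \sigma, \mathcal{Q} \rangle$ where $\mathcal{P}$ is a DCOP, $\sigma$ is a complete solution to $\mathcal{P}$, and $\mathcal{Q} = \langle a_Q, \sigma_Q, \hat{\sigma}_Q\rangle$ is a query: $a_Q \in \mathbf{A}$ is the queried agent; $\sigma_Q \subseteq \sigma$ is the restriction of $\sigma$ to a subset $\mathrm{var}(\sigma_Q)$ of the variables; and $\hat{\sigma}_Q$ is an alternative assignment to the same variables, $\mathrm{var}(\hat{\sigma}_Q) = \mathrm{var}(\sigma_Q)$, with $\hat{\sigma}_Q(x) \neq \sigma_Q(x)$ for every $x \in \mathrm{var}(\sigma_Q)$. Write $\hat\sigma = (\sigma \setminus \sigma_Q) \cup \hat{\sigma}_Q$ for the complete solution obtained from $\sigma$ by replacing $\sigma_Q$ by $\hat{\sigma}_Q$. A contrastive explanation for $\langle \mathcal{P}, \sigma, \mathcal{Q} \rangle$ is a tuple $\langle \mathbf{F}_{\downarrow \sigma_Q}, \mathbf{F}_{\downarrow \hat{\sigma}_Q}, \mathbf{F}_{\downarrow \sigma_Q}(\sigma_Q), \mathbf{F}_{\downarrow \hat{\sigma}_Q}(\hat{\sigma}_Q)\rangle$ where: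 $\mathbf{F}_{\downarrow \sigma_Q}$ is the set of all constraints whose scope includes a variable of $\mathrm{var}(\sigma_Q)$, grounded by $\sigma$; $\mathbf{F}_{\downarrow \hat{\sigma}_Q}$ is a possibly partial set (i.e. any subset) of the constraints whose scope includes a variable of $\mathrm{var}(\hat{\sigma}_Q)$, grounded by $\hat\sigma$; $\mathbf{F}_{\downarrow \sigma_Q}(\sigma_Q) = \sum_{f \in \mathbf{F}_{\downarrow \sigma_Q}} f(\sigma)$; and $\mathbf{F}_{\downarrow \hat{\sigma}_Q}(\hat{\sigma}_Q) = \sum_{f \in \mathbf{F}_{\downarrow \hat{\sigma}_Q}} f(\hat\sigma)$. It is valid iff $\mathbf{F}_{\downarrow \sigma_Q}(\sigma_Q) \leq \mathbf{F}_{\downarrow \hat{\sigma}_Q}(\hat{\sigma}_Q)$.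
   Formalization: The formal theorem additionally assumes that every constraint whose scope contains no query variable has finite cost under σ; without this the claim fails, since an unrelated constraint of cost ∞ makes every solution k-optimal. *)

theory Defs
  imports "HOL-Library.Extended_Real" "HOL-Library.FuncSet"
begin

text \<open>
  Assignments are partial maps, so \<open>var \<sigma>\<close> is \<^term>\<open>dom \<sigma>\<close>, the restriction of \<open>\<sigma>\<close> to a set \<open>S\<close> is
  \<^term>\<open>\<sigma> |` S\<close>, and \<open>\<sigma>\<^sub>Q \<subseteq> \<sigma>\<close> is \<^term>\<open>\<sigma>\<^sub>Q \<subseteq>\<^sub>m \<sigma>\<close>. All variable domains are subsets of one value type.
\<close>

record ('x, 'v) constraint =
  scope :: "'x set"
  cost :: "('x \<rightharpoonup> 'v) \<Rightarrow> ereal"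

record ('a, 'x, 'v) dcop =
  agents :: "'a set"
  variables :: "'x set"
  domain_of :: "'x \<Rightarrow> 'v set"
  constraints :: "('x, 'v) constraint set"
  owner :: "'x \<Rightarrow> 'a"

definition assignments :: "('x \<Rightarrow> 'v set) \<Rightarrow> 'x set \<Rightarrow> ('x \<rightharpoonup> 'v) set" where
  "assignments D S = {\<sigma>. dom \<sigma> = S \<and> (\<forall>x v. \<sigma> x = Some v \<longrightarrow> v \<in> D x)}"

text \<open>
  The extensional function space makes a cost function carry no information outside the
  product of the domains of its scope, so that equality of constraints is the intended one
  and the set of constraints has no spurious duplicates. Costs range over the reals
  and \<open>\<infinity>\<close>, but not \<open>-\<infinity>\<close>.
\<close>

definition is_dcop :: "('a, 'x, 'v) dcop \<Rightarrow> bool" where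
  "is_dcop P \<longleftrightarrow>
     finite (agents P) \<and>
     finite (variables P) \<and>
     (\<forall>x\<in>variables P. finite (domain_of P x)) \<and>
     finite (constraints P) \<and>
     (\<forall>f\<in>constraints P. scope f \<subseteq> variables P \<and>
        cost f \<in> assignments (domain_of P) (scope f) \<rightarrow>\<^sub>E {-\<infinity><..}) \<and>
     owner P \<in> variables P \<rightarrow> agents P"

definition is_solution :: "('a, 'x, 'v) dcop \<Rightarrow> ('x \<rightharpoonup> 'v) \<Rightarrow> bool" where
  "is_solution P \<sigma> \<longleftrightarrow> dom \<sigma> \<subseteq> variables P \<and> \<sigma> \<in> assignments (domain_of P) (dom \<sigma>)"

definition is_complete_solution :: "('a, 'x, 'v) dcop \<Rightarrow> ('x \<rightharpoonup> 'v) \<Rightarrow> bool" where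
  "is_complete_solution P \<sigma> \<longleftrightarrow> is_solution P \<sigma> \<and> dom \<sigma> = variables P"

type_synonym ('x, 'v) grounded = "('x, 'v) constraint \<times> ('x \<rightharpoonup> 'v)"

definition ground :: "('x \<rightharpoonup> 'v) \<Rightarrow> ('x, 'v) constraint \<Rightarrow> ('x, 'v) grounded" where
  "ground \<tau> f = (f, \<tau> |` scope f)"

definition grounded_cost :: "('x, 'v) grounded \<Rightarrow> ereal" where
  "grounded_cost g = cost (fst g) (snd g)"

definition total_cost :: "('a, 'x, 'v) dcop \<Rightarrow> ('x \<rightharpoonup> 'v) \<Rightarrow> ereal" where
  "total_cost P \<tau> = (\<Sum>f\<in>constraints P. grounded_cost (ground \<tau> f))"

text \<open>
  Solutions need not be feasible. If a constraint that a change does not touch has cost \<open>\<infinity>\<close>,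
  the total cost is \<open>\<infinity>\<close> before and after, and so the change is never an improvement.
\<close>

definition k_optimal :: "('a, 'x, 'v) dcop \<Rightarrow> nat \<Rightarrow> ('x \<rightharpoonup> 'v) \<Rightarrow> bool" where
  "k_optimal P k \<sigma> \<longleftrightarrow>
     is_complete_solution P \<sigma> \<and>
     \<not> (\<exists>\<tau>. is_complete_solution P \<tau> \<and> card {x \<in> variables P. \<tau> x \<noteq> \<sigma> x} \<le> k \<and>
          total_cost P \<tau> < total_cost P \<sigma>)"

type_synonym ('a, 'x, 'v) query = "'a \<times> ('x \<rightharpoonup> 'v) \<times> ('x \<rightharpoonup> 'v)"

fun is_query :: "('a, 'x, 'v) dcop \<Rightarrow> ('x \<rightharpoonup> 'v) \<Rightarrow> ('a, 'x, 'v) query \<Rightarrow> bool" where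
  "is_query P \<sigma> (a\<^sub>Q, \<sigma>\<^sub>Q, \<sigma>\<^sub>Q') \<longleftrightarrow>
     a\<^sub>Q \<in> agents P \<and>
     \<sigma>\<^sub>Q \<subseteq>\<^sub>m \<sigma> \<and>
     is_solution P \<sigma>\<^sub>Q' \<and>
     dom \<sigma>\<^sub>Q' = dom \<sigma>\<^sub>Q \<and>
     (\<forall>x\<in>dom \<sigma>\<^sub>Q. \<sigma>\<^sub>Q' x \<noteq> \<sigma>\<^sub>Q x)"

definition is_xdcop :: "('a, 'x, 'v) dcop \<Rightarrow> ('x \<rightharpoonup> 'v) \<Rightarrow> ('a, 'x, 'v) query \<Rightarrow> bool" where
  "is_xdcop P \<sigma> Q \<longleftrightarrow> is_dcop P \<and> is_complete_solution P \<sigma> \<and> is_query P \<sigma> Q"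

definition involving :: "('a, 'x, 'v) dcop \<Rightarrow> 'x set \<Rightarrow> ('x, 'v) constraint set" where
  "involving P V = {f \<in> constraints P. scope f \<inter> V \<noteq> {}}"

type_synonym ('x, 'v) explanation =
  "('x, 'v) grounded set \<times> ('x, 'v) grounded set \<times> ereal \<times> ereal"

text \<open>
  The override \<^term>\<open>\<sigma> ++ \<sigma>\<^sub>Q'\<close> is \<open>(\<sigma> - \<sigma>\<^sub>Q) \<union> \<sigma>\<^sub>Q'\<close>, because \<open>\<sigma>\<^sub>Q\<close> and \<open>\<sigma>\<^sub>Q'\<close> have the same domain.
\<close>

fun is_explanation ::
  "('a, 'x, 'v) dcop \<Rightarrow> ('x \<rightharpoonup> 'v) \<Rightarrow> ('a, 'x, 'v) query \<Rightarrow> ('x, 'v) explanation \<Rightarrow> bool" where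
  "is_explanation P \<sigma> (a\<^sub>Q, \<sigma>\<^sub>Q, \<sigma>\<^sub>Q') (G, G', c, c') \<longleftrightarrow>
     G = ground \<sigma> ` involving P (dom \<sigma>\<^sub>Q) \<and>
     G' \<subseteq> ground (\<sigma> ++ \<sigma>\<^sub>Q') ` involving P (dom \<sigma>\<^sub>Q') \<and>
     c = (\<Sum>g\<in>G. grounded_cost g) \<and>
     c' = (\<Sum>g\<in>G'. grounded_cost g)"

fun valid_explanation :: "('x, 'v) explanation \<Rightarrow> bool" where
  "valid_explanation (G, G', c, c') \<longleftrightarrow> c \<le> c'"

end

theory Submission
  imports Defs
begin

text \<open>
  The overridden assignment differs from \<open>\<sigma>\<close> only on the queried variables, so
  \<open>k\<close>-optimality gives that it does not decrease the total cost. Constraints not touching a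
  queried variable are grounded identically by both and have finite cost; cancelling them
  leaves validity of the explanation that uses all constraints touching a queried variable.
\<close>

text \<open>The constraint survives as the first component of the pair. Hence passing to a set of
  grounded constraints merges no summands, and the sums in an explanation can be reindexed to sums
  over constraints.\<close>

lemma inj_on_ground: "inj_on (ground \<tau>) F"
  by (simp add: inj_on_def ground_def)

lemma sum_grounded_cost_image:
  "(\<Sum>g\<in>ground \<tau> ` F. grounded_cost g) = (\<Sum>f\<in>F. grounded_cost (ground \<tau> f))"
  by (simp add: sum.reindex[OF inj_on_ground])

lemma involving_subset: "involving P V \<subseteq> constraints P"
  by (auto simp: involving_def)

lemma total_cost_split:
  assumes "is_dcop P"
  shows "total_cost P \<tau> =
    (\<Sum>f\<in>involving P V. grounded_cost (ground \<tau> f)) +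
    (\<Sum>f\<in>constraints P - involving P V. grounded_cost (ground \<tau> f))"
proof -
  have "finite (constraints P)"
    using assms by (simp add: is_dcop_def)
  from sum.subset_diff[OF involving_subset this] show ?thesis
    unfolding total_cost_def by (simp add: add.commute)
qed

text \<open>A complete solution restricts to a point of the product of the scope's domains, where
  the codomain of \<open>cost f\<close> excludes -\<infinity>. This gives half of the finiteness
  needed for cancellation.\<close>

lemma grounded_cost_neq_MInf:
  assumes P: "is_dcop P" and \<tau>: "is_complete_solution P \<tau>" and f: "f \<in> constraints P"
  shows "grounded_cost (ground \<tau> f) \<noteq> -\<infinity>"
proof -
  have sub: "scope f \<subseteq> dom \<tau>"
    and cost: "cost f \<in> assignments (domain_of P) (scope f) \<rightarrow>\<^sub>E {-\<infinity><..}"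
    using P \<tau> f by (auto simp: is_dcop_def is_complete_solution_def)
  have "\<tau> \<in> assignments (domain_of P) (dom \<tau>)"
    using \<tau> unfolding is_complete_solution_def is_solution_def by blast
  with sub have "\<tau> |` scope f \<in> assignments (domain_of P) (scope f)"
    by (auto simp: assignments_def restrict_map_def split: if_splits)
  from PiE_mem[OF cost this] show ?thesis
    by (simp add: grounded_cost_def ground_def)
qed

lemma ground_map_add:
  assumes "f \<in> constraints P - involving P (dom \<rho>)"
  shows "ground (\<sigma> ++ \<rho>) f = ground \<sigma> f"
proof -
  have "scope f \<inter> dom \<rho> = {}"
    using assms by (auto simp: involving_def)
  then show ?thesis
    by (auto simp: ground_def restrict_map_def fun_eq_iff map_add_dom_app_simps disjoint_iff)
qed

lemma is_complete_solution_map_add: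
  assumes "is_complete_solution P \<sigma>" "is_solution P \<rho>"
  shows "is_complete_solution P (\<sigma> ++ \<rho>)"
  using assms
  by (auto simp: is_complete_solution_def is_solution_def assignments_def map_add_Some_iff)

theorem theorem1:
  fixes P :: "('a, 'x, 'v) dcop"
    and \<sigma> \<sigma>\<^sub>Q \<sigma>\<^sub>Q' :: "'x \<rightharpoonup> 'v"
    and a\<^sub>Q :: 'a
    and k :: nat
  assumes xdcop: "is_xdcop P \<sigma> (a\<^sub>Q, \<sigma>\<^sub>Q, \<sigma>\<^sub>Q')"
    and k_pos: "0 < k"
    and opt: "k_optimal P k \<sigma>"
    and size: "card (dom \<sigma>\<^sub>Q) \<le> k"
    and finite_rest: "\<forall>f \<in> constraints P - involving P (dom \<sigma>\<^sub>Q). grounded_cost (ground \<sigma> f) \<noteq> \<infinity>"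
  shows "\<exists>E. is_explanation P \<sigma> (a\<^sub>Q, \<sigma>\<^sub>Q, \<sigma>\<^sub>Q') E \<and> valid_explanation E"
proof -
  define \<tau> where "\<tau> = \<sigma> ++ \<sigma>\<^sub>Q'"
  define I where "I = involving P (dom \<sigma>\<^sub>Q)"
  define R where "R = constraints P - I"
  let ?rest = "\<Sum>f\<in>R. grounded_cost (ground \<sigma> f)"
  have P: "is_dcop P" and \<sigma>: "is_complete_solution P \<sigma>" and \<rho>: "is_solution P \<sigma>\<^sub>Q'"
    and dom: "dom \<sigma>\<^sub>Q' = dom \<sigma>\<^sub>Q"
    using xdcop by (auto simp: is_xdcop_def)
  \<comment> \<open>\<open>card_mono\<close> below needs a finite superset; an infinite one would
    have \<open>card\<close> 0.\<close>
  have "finite (dom \<sigma>\<^sub>Q)"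
    using P \<rho> dom by (auto simp: is_dcop_def is_solution_def intro: finite_subset)
  moreover have "{x \<in> variables P. \<tau> x \<noteq> \<sigma> x} \<subseteq> dom \<sigma>\<^sub>Q"
    unfolding \<tau>_def dom[symmetric] by (auto simp: map_add_def split: option.splits)
  ultimately have "card {x \<in> variables P. \<tau> x \<noteq> \<sigma> x} \<le> k"
    using size card_mono order_trans by blast
  moreover have "is_complete_solution P \<tau>"
    unfolding \<tau>_def using \<sigma> \<rho> by (rule is_complete_solution_map_add)
  ultimately have "total_cost P \<sigma> \<le> total_cost P \<tau>"
    using opt by (auto simp: k_optimal_def not_less)
  \<comment> \<open>Rewriting with \<open>dom[symmetric]\<close> expresses \<open>R\<close> through
    the domain of the overriding map, the form \<open>ground_map_add\<close> expects.\<close>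
  moreover have "(\<Sum>f\<in>R. grounded_cost (ground \<tau> f)) = ?rest"
    unfolding R_def I_def \<tau>_def dom[symmetric] by (rule sum.cong) (simp_all only: ground_map_add)
  ultimately have "(\<Sum>f\<in>I. grounded_cost (ground \<sigma> f)) + ?rest
      \<le> (\<Sum>f\<in>I. grounded_cost (ground \<tau> f)) + ?rest"
    using total_cost_split[OF P, of _ "dom \<sigma>\<^sub>Q"] by (simp add: I_def R_def)
  \<comment> \<open>In \<open>ereal\<close>, a common summand \<infinity> would make both sides
    \<infinity> and hide the comparison over \<open>I\<close>. Here \<open>finite_rest\<close>
    excludes \<infinity>, and the codomain of the costs excludes -\<infinity>. The sums over
    \<open>I\<close> themselves may still be \<infinity>.\<close>
  moreover have "\<bar>?rest\<bar> \<noteq> \<infinity>"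
  proof -
    have "\<bar>grounded_cost (ground \<sigma> f)\<bar> \<noteq> \<infinity>" if "f \<in> R" for f
      using that finite_rest grounded_cost_neq_MInf[OF P \<sigma>, of f] by (auto simp: R_def I_def)
    then show ?thesis
      by (simp add: sum_Inf)
  qed
  ultimately have "(\<Sum>f\<in>I. grounded_cost (ground \<sigma> f)) \<le> (\<Sum>f\<in>I. grounded_cost (ground \<tau> f))"
    by (auto simp: ereal_add_le_add_iff2)
  then have "valid_explanation (ground \<sigma> ` I, ground \<tau> ` I,
      \<Sum>g\<in>ground \<sigma> ` I. grounded_cost g, \<Sum>g\<in>ground \<tau> ` I. grounded_cost g)"
    by (simp add: sum_grounded_cost_image)
  \<comment> \<open>By \<open>dom\<close>, both assignments involve the same constraints
    \<open>I\<close>, so the inclusion required of the second component holds with equality.\<close>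
  moreover have "is_explanation P \<sigma> (a\<^sub>Q, \<sigma>\<^sub>Q, \<sigma>\<^sub>Q') (ground \<sigma> ` I, ground \<tau> ` I,
      \<Sum>g\<in>ground \<sigma> ` I. grounded_cost g, \<Sum>g\<in>ground \<tau> ` I. grounded_cost g)"
    by (simp add: I_def \<tau>_def dom)
  ultimately show ?thesis
    by blast
qed

end
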